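(* Let $a,b\in\mathbb{N}$ and $\alpha\in C^\infty((-1,1),[0,1])$, and let $(M,\mathcal{D},g)$ be the sub-Riemannian manifold determined by $a$, $b$ and $\alpha$. Let $\gamma:(-1,1)\to M$, $\gamma(t):=(0,t,0)$. Fix $t_1,t_2\in(-1,1)$ with $t_1<t_2$. Then the curve $\gamma|_{[t_1,t_2]}$ is normal if and only if $\alpha(t)=0$ for all $t\in[t_1,t_2]$.
   Context: Notation: $\mathbb{N}=\{1,2,3,\dots\}$. Let $M:=(-\tfrac12,\tfrac12)\times(-1,1)\times\mathbb{R}\subset\mathbb{R}^3$ with coordinates $x=(x_1,x_2,x_3)$. For $b\in\mathbb{N}$ define the vector fields on $M$ $$X_1(x):=\partial_1,\qquad X_2(x):=\partial_2+x_1^2x_2^b\,\partial_3,$$ and the distribution $\mathcal{D}:=\mathrm{span}\{X_1,X_2\}$. For $a\in\mathbb{N}$ and $\alpha\in C^\infty((-1,1),[0,1])$ let $g$ be the Riemannian metric on $\mathcal{D}$ given by $$g_x(X_1,X_1)=1,\quad g_x(X_1,X_2)=0,\quad g_x(X_2,X_2)=1-\alpha(x_2)\,x_1x_2^a,\qquad x\in M.$$ An absolutely continuous curve $\eta:I\to M$ on an interval $I$ is horizontal if $\dot\eta(t)\in\mathcal{D}_{\eta(t)}$ for almost every $t\in I$. The normal Hamiltonian $H\in C^\infty(T^*M)$ is $$H(\xi):=\tfrac12\Big(\max\{\langle\xi,v\rangle \mid v\in\mathcal{D}_x,\ g_x(v,v)=1\}\Big)^2,\qquad \xi\in T^*_xM,\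 x\in M;$$ equivalently $H(\xi)=\tfrac12(\langle\xi,V\rangle^2+\langle\xi,W\rangle^2)$ for any $g$-orthonormal frame $V,W$ of $\mathcal{D}$. A curve $\lambda:I\to T^*M$ solves the Hamilton equations for $H$ if $\dot\lambda=\vec H(\lambda)$, where $\vec H$ is the Hamiltonian vector field of $H$ with respect to the canonical symplectic form on $T^*M$; in canonical coordinates $(x,p)$ this reads $\dot x=\partial H/\partial p$, $\dot p=-\partial H/\partial x$. A horizontal curve $\eta:I\to M$ is normal if there exists a lift $\lambda:I\to T^*M$ of $\eta$ (i.e. $\lambda(t)\in T^*_{\eta(t)}M$ for all $t\in I$) solving the Hamilton equations for $H$. *)

theory Defs
  imports "HOL-Analysis.Analysis"
begin

definition smooth_on_open :: "real set \<Rightarrow> (real \<Rightarrow> real) \<Rightarrow> bool" where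
  "smooth_on_open S f \<longleftrightarrow> open S \<and> (\<forall>n. \<forall>t\<in>S. (deriv ^^ n) f differentiable (at t))"

text \<open>Absolute continuity on an interval, required on each compact subinterval (on a compact
  interval this is the usual notion).\<close>

definition absolutely_continuous_curve ::
    "real set \<Rightarrow> (real \<Rightarrow> 'a::metric_space) \<Rightarrow> bool" where
  "absolutely_continuous_curve I \<eta> \<longleftrightarrow>
    (\<forall>c d. {c..d} \<subseteq> I \<longrightarrow>
      (\<forall>\<epsilon>>0. \<exists>\<delta>>0. \<forall>(n::nat) l u.
        (\<forall>i<n. l i \<le> u i \<and> {l i..u i} \<subseteq> {c..d}) \<and>
        disjoint_family_on (\<lambda>i. {l i<..<u i}) {..<n} \<and>
        (\<Sum>i<n. u i - l i) < \<delta>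
        \<longrightarrow> (\<Sum>i<n. dist (\<eta> (l i)) (\<eta> (u i))) < \<epsilon>))"


text \<open>
  Sub-Riemannian structures on an open set \<open>M\<close> of \<open>\<real>\<^sup>3\<close>.  The tangent and cotangent
  spaces at each point are identified with \<^typ>\<open>real^3\<close> by the coordinate frames, so a covector
  \<open>p\<close> pairs with a vector \<open>v\<close> as \<open>p \<bullet> v\<close>, and \<open>T\<^sup>*M\<close> is \<open>M \<times> UNIV\<close>, with
  elements written in canonical coordinates \<open>(x, p)\<close>.
\<close>

type_synonym distribution = "real^3 \<Rightarrow> (real^3) set"
type_synonym metric = "real^3 \<Rightarrow> real^3 \<Rightarrow> real^3 \<Rightarrow> real"
type_synonym phase = "(real^3) \<times> (real^3)"

definition horizontal_curve ::
    "(real^3) set \<Rightarrow> distribution \<Rightarrow> real set \<Rightarrow> (real \<Rightarrow> real^3) \<Rightarrow> bool" where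
  "horizontal_curve M D I \<eta> \<longleftrightarrow>
    is_interval I \<and> \<eta> ` I \<subseteq> M \<and> absolutely_continuous_curve I \<eta> \<and>
    (AE t in lebesgue. t \<in> I \<longrightarrow>
      (\<exists>v\<in>D (\<eta> t). (\<eta> has_vector_derivative v) (at t within I)))"

text \<open>\<open>GREATEST\<close> denotes the maximum, which exists whenever \<open>D x \<noteq> {0}\<close> and \<open>g x\<close> is positive
  definite on \<open>D x\<close>.\<close>

definition normal_hamiltonian :: "distribution \<Rightarrow> metric \<Rightarrow> phase \<Rightarrow> real" where
  "normal_hamiltonian D g = (\<lambda>(x, p).
    (1/2) * (GREATEST r. \<exists>v\<in>D x. g x v v = 1 \<and> r = p \<bullet> v)\<^sup>2)"

text \<open>The field \<open>(\<partial>H/\<partial>p, -\<partial>H/\<partial>x)\<close>, meaningful where \<open>H\<close> is differentiable.\<close>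

definition hamiltonian_vector_field :: "(phase \<Rightarrow> real) \<Rightarrow> phase \<Rightarrow> phase" where
  "hamiltonian_vector_field H \<xi> =
    ((\<chi> i. frechet_derivative H (at \<xi>) (0, axis i 1)),
     (\<chi> i. - frechet_derivative H (at \<xi>) (axis i 1, 0)))"

definition solves_hamilton_equations ::
    "(phase \<Rightarrow> real) \<Rightarrow> real set \<Rightarrow> (real \<Rightarrow> phase) \<Rightarrow> bool" where
  "solves_hamilton_equations H I \<Lambda> \<longleftrightarrow>
    (\<forall>t\<in>I. (\<Lambda> has_vector_derivative hamiltonian_vector_field H (\<Lambda> t)) (at t within I))"

definition normal_curve ::
    "(real^3) set \<Rightarrow> distribution \<Rightarrow> metric \<Rightarrow> real set \<Rightarrow> (real \<Rightarrow> real^3) \<Rightarrow> bool" where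
  "normal_curve M D g I \<eta> \<longleftrightarrow>
    horizontal_curve M D I \<eta> \<and>
    (\<exists>\<Lambda>. (\<forall>t\<in>I. fst (\<Lambda> t) = \<eta> t) \<and>
         solves_hamilton_equations (normal_hamiltonian D g) I \<Lambda>)"


definition manifold_M :: "(real^3) set" where
  "manifold_M = {x. x$1 \<in> {-1/2<..<1/2} \<and> x$2 \<in> {-1<..<1}}"

definition X1 :: "real^3 \<Rightarrow> real^3" where
  "X1 x = vector [1, 0, 0]"

definition X2 :: "nat \<Rightarrow> real^3 \<Rightarrow> real^3" where
  "X2 b x = vector [0, 1, (x$1)\<^sup>2 * (x$2)^b]"

definition dist_D :: "nat \<Rightarrow> distribution" where
  "dist_D b x = span {X1 x, X2 b x}"

text \<open>For \<open>v \<in> dist_D b x\<close> the coefficients of \<open>v\<close> in the frame \<open>X1 x, X2 b x\<close> are \<open>v$1\<close> and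
  \<open>v$2\<close>; hence the formula below is the bilinear form with the prescribed values on the frame, as
  the lemma following it states.  Off \<open>dist_D b x\<close> its values have no meaning.\<close>

definition metric_g :: "nat \<Rightarrow> (real \<Rightarrow> real) \<Rightarrow> metric" where
  "metric_g a \<alpha> x v w = v$1 * w$1 + (1 - \<alpha> (x$2) * x$1 * (x$2)^a) * (v$2 * w$2)"

lemma metric_g_frame:
  "metric_g a \<alpha> x (c1 *\<^sub>R X1 x + c2 *\<^sub>R X2 b x) (d1 *\<^sub>R X1 x + d2 *\<^sub>R X2 b x) =
    c1 * d1 * 1 + (c1 * d2 + c2 * d1) * 0 + c2 * d2 * (1 - \<alpha> (x$2) * x$1 * (x$2)^a)"
  by (simp add: metric_g_def X1_def X2_def)

definition curve_gamma :: "real \<Rightarrow> real^3" where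
  "curve_gamma t = vector [0, t, 0]"

end

theory Submission
  imports Defs
begin

text \<open>
  With \<open>u = p\<^sub>2 + x\<^sub>1\<^sup>2 x\<^sub>2\<^sup>b p\<^sub>3\<close> and \<open>w = 1 - \<alpha>(x\<^sub>2) x\<^sub>1 x\<^sub>2\<^sup>a\<close>, which is positive on the
  manifold, the frame \<open>X\<^sub>1, X\<^sub>2 / \<surd>w\<close> is orthonormal, so near every covector over the manifold
  the Hamiltonian is \<open>H = (p\<^sub>1\<^sup>2 + u\<^sup>2 / w) / 2\<close> (lemma \<open>normal_hamiltonian_eq\<close>).  On the plane
  \<open>x\<^sub>1 = 0\<close> the anholonomy term \<open>x\<^sub>1\<^sup>2 x\<^sub>2\<^sup>b p\<^sub>3\<close> vanishes to second order and only the metric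
  perturbation survives in the differential:
  \<open>dH = p\<^sub>1 dp\<^sub>1 + p\<^sub>2 dp\<^sub>2 + (p\<^sub>2\<^sup>2 \<alpha>(x\<^sub>2) x\<^sub>2\<^sup>a / 2) dx\<^sub>1\<close>.

  Consequently a lift of \<open>t \<mapsto> (0, t, 0)\<close> that solves the Hamilton equations must have \<open>p\<^sub>1 = 0\<close>
  and \<open>p\<^sub>2 = 1\<close>, from the equations for \<open>x\<^sub>1\<close> and \<open>x\<^sub>2\<close>, whereas the equation for \<open>p\<^sub>1\<close> reads
  \<open>p\<^sub>1' = - \<alpha>(t) t\<^sup>a / 2\<close>.  Hence \<open>\<alpha>\<close> vanishes on the interval except possibly at \<open>0\<close>, and
  there too by continuity, since \<open>0\<close> is not isolated in an interval of positive length.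
  Conversely, if \<open>\<alpha>\<close> vanishes along the curve, the constant covector \<open>(0, 1, 0)\<close> is such a lift;
  the curve is horizontal in any case, being a unit-speed integral curve of \<open>X\<^sub>2\<close>.
\<close>

section \<open>The Hamiltonian in coordinates\<close>

lemma in_dist_D_iff: "v \<in> dist_D b x \<longleftrightarrow> v$3 = v$2 * ((x$1)\<^sup>2 * (x$2)^b)"
proof -
  have "v \<in> dist_D b x \<longleftrightarrow> (\<exists>c d. v - c *\<^sub>R X1 x = d *\<^sub>R X2 b x)"
    by (auto simp: dist_D_def span_insert span_singleton)
  also have "\<dots> \<longleftrightarrow> v$3 = v$2 * ((x$1)\<^sup>2 * (x$2)^b)"
    by (auto simp: vec_eq_iff forall_3 X1_def X2_def)
  finally show ?thesis .
qed

text \<open>The dual norm of a weighted Euclidean norm on the plane: the upper bound is the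
  Cauchy--Schwarz inequality.  If the claimed maximum \<open>m\<close> is nonzero, it is attained at
  \<open>(p / m, u / (w m))\<close>, the normalised gradient of the functional with respect to the weighted
  norm; otherwise the functional vanishes and every point of the ellipse attains it.\<close>

lemma Greatest_linear_on_ellipse:
  fixes p u w :: real
  assumes w: "w > 0"
  shows "(GREATEST r. \<exists>c d. c\<^sup>2 + w * d\<^sup>2 = 1 \<and> r = p * c + u * d) = sqrt (p\<^sup>2 + u\<^sup>2 / w)"
proof (rule Greatest_equality)
  let ?m = "sqrt (p\<^sup>2 + u\<^sup>2 / w)"
  have nonneg: "0 \<le> p\<^sup>2 + u\<^sup>2 / w" using w by simp
  then have m2: "?m\<^sup>2 = p\<^sup>2 + u\<^sup>2 / w" by simp
  show "\<exists>c d. c\<^sup>2 + w * d\<^sup>2 = 1 \<and> ?m = p * c + u * d"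
  proof (cases "?m = 0")
    case True
    then have "p = 0" "u = 0"
      using w by (auto simp: add_nonneg_eq_0_iff)
    then show ?thesis by (intro exI[of _ 1] exI[of _ 0]) simp
  next
    case False
    have "(p / m)\<^sup>2 + w * (u / (w * m))\<^sup>2 = (p\<^sup>2 + u\<^sup>2 / w) / m\<^sup>2" if "m \<noteq> 0" for m
      using w that by (simp add: field_simps power2_eq_square)
    then have "(p / ?m)\<^sup>2 + w * (u / (w * ?m))\<^sup>2 = (p\<^sup>2 + u\<^sup>2 / w) / ?m\<^sup>2"
      using False by blast
    also have "\<dots> = 1" using m2 False by (metis div_self zero_eq_power2)
    finally have 1: "(p / ?m)\<^sup>2 + w * (u / (w * ?m))\<^sup>2 = 1" .
    have "p * (p / ?m) + u * (u / (w * ?m)) = ?m\<^sup>2 / ?m"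
      unfolding m2 by (simp add: add_divide_distrib power2_eq_square)
    also have "\<dots> = ?m" by (metis False nonzero_mult_div_cancel_right power2_eq_square)
    finally show ?thesis using 1 by metis
  qed
  fix r assume "\<exists>c d. c\<^sup>2 + w * d\<^sup>2 = 1 \<and> r = p * c + u * d"
  then obtain c d where cd: "c\<^sup>2 + w * d\<^sup>2 = 1" and r: "r = p * c + u * d" by blast
  \<comment> \<open>The Lagrange identity, which quantifies the defect in the Cauchy--Schwarz inequality.\<close>
  have "(p\<^sup>2 + u\<^sup>2 / w) * (c\<^sup>2 + w * d\<^sup>2) - r\<^sup>2 = (w * p * d - u * c)\<^sup>2 / w"
    unfolding r using w by (simp add: field_simps power2_eq_square)
  also have "\<dots> \<ge> 0" using w by simp
  finally have "r\<^sup>2 \<le> p\<^sup>2 + u\<^sup>2 / w" using cd by simp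
  then show "r \<le> ?m" by (rule real_le_rsqrt)
qed

lemma normal_hamiltonian_eq:
  assumes w: "1 - \<alpha> (x$2) * x$1 * (x$2)^a > 0"
  shows "normal_hamiltonian (dist_D b) (metric_g a \<alpha>) (x, p) =
    (1/2) * ((p$1)\<^sup>2 + (p$2 + (x$1)\<^sup>2 * (x$2)^b * p$3)\<^sup>2 / (1 - \<alpha> (x$2) * x$1 * (x$2)^a))"
proof -
  let ?w = "1 - \<alpha> (x$2) * x$1 * (x$2)^a"
  let ?u = "p$2 + (x$1)\<^sup>2 * (x$2)^b * p$3"
  have "(\<exists>v\<in>dist_D b x. metric_g a \<alpha> x v v = 1 \<and> r = p \<bullet> v) \<longleftrightarrow>
      (\<exists>c d. c\<^sup>2 + ?w * d\<^sup>2 = 1 \<and> r = p$1 * c + ?u * d)" (is "?L \<longleftrightarrow> ?R") for r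
  proof
    assume ?L
    then obtain v where "v \<in> dist_D b x" "metric_g a \<alpha> x v v = 1" "r = p \<bullet> v" by blast
    then show ?R
      by (intro exI[of _ "v$1"] exI[of _ "v$2"])
        (simp add: in_dist_D_iff metric_g_def inner_vec_def sum_3 power2_eq_square algebra_simps)
  next
    assume ?R
    then obtain c d where "c\<^sup>2 + ?w * d\<^sup>2 = 1" "r = p$1 * c + ?u * d" by blast
    then show ?L
      by (intro bexI[of _ "vector [c, d, d * ((x$1)\<^sup>2 * (x$2)^b)]"])
        (simp_all add: in_dist_D_iff metric_g_def inner_vec_def sum_3 power2_eq_square algebra_simps)
  qed
  moreover have "0 \<le> (p$1)\<^sup>2 + ?u\<^sup>2 / ?w" using w by simp
  ultimately show ?thesis
    by (simp add: normal_hamiltonian_def Greatest_linear_on_ellipse[OF w])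
qed

text \<open>The bound \<open>\<bar>x\<^sub>1\<bar> < 1/2\<close> in the definition of the manifold is what keeps the metric positive
  definite.\<close>

lemma metric_coefficient_pos:
  assumes "\<alpha> ` {-1<..<1} \<subseteq> {0..1}" and "x \<in> manifold_M"
  shows "1 - \<alpha> (x$2) * x$1 * (x$2)^a > 0"
proof -
  have x: "\<bar>x$1\<bar> < 1/2" "\<bar>x$2\<bar> < 1" "\<bar>\<alpha> (x$2)\<bar> \<le> 1"
    using assms by (auto simp: manifold_M_def image_subset_iff)
  have "\<bar>\<alpha> (x$2) * x$1 * (x$2)^a\<bar> = \<bar>\<alpha> (x$2)\<bar> * \<bar>x$2\<bar>^a * \<bar>x$1\<bar>"
    by (simp add: abs_mult power_abs)
  also have "\<dots> \<le> 1 * \<bar>x$1\<bar>"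
    using x by (intro mult_right_mono mult_le_one power_le_one) auto
  finally show ?thesis using x by linarith
qed

lemma open_manifold_M: "open manifold_M"
proof -
  have eq: "manifold_M = {x. - 1/2 < x$1} \<inter> {x. x$1 < 1/2} \<inter> {x. - 1 < x$2} \<inter> {x. x$2 < 1}"
    by (auto simp: manifold_M_def)
  show ?thesis unfolding eq by (intro open_Int open_Collect_less continuous_intros)
qed

lemma curve_gamma_in_manifold_M: "t \<in> {-1<..<1} \<Longrightarrow> curve_gamma t \<in> manifold_M"
  by (simp add: curve_gamma_def manifold_M_def)

section \<open>The Hamiltonian vector field along the curve\<close>

text \<open>On the plane \<open>x\<^sub>1 = 0\<close> the coefficient \<open>w\<close> equals \<open>1\<close>, and it depends on \<open>\<alpha>\<close> only through
  the product \<open>\<alpha>(x\<^sub>2) x\<^sub>1\<close>.  The derivative of \<open>\<alpha>\<close> is therefore multiplied by \<open>x\<^sub>1 = 0\<close>, and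
  only the value of \<open>\<alpha>\<close> enters the differential.\<close>

lemma normal_hamiltonian_has_derivative:
  assumes \<alpha>: "\<alpha> differentiable (at t)" "\<alpha> ` {-1<..<1} \<subseteq> {0..1}" and t: "t \<in> {-1<..<1}"
  shows "(normal_hamiltonian (dist_D b) (metric_g a \<alpha>) has_derivative
    (\<lambda>(dx, dp). p$1 * dp$1 + p$2 * dp$2 + (1/2) * (p$2)\<^sup>2 * (\<alpha> t * t^a) * dx$1))
    (at (curve_gamma t, p))"
proof -
  obtain D where D: "(\<alpha> has_derivative D) (at t)"
    using \<alpha>(1) by (auto simp: differentiable_def)
  let ?\<xi> = "(curve_gamma t, p)"
  have \<alpha>_x2: "((\<lambda>\<xi>. \<alpha> (fst \<xi> $ 2)) has_derivative (\<lambda>d. D (fst d $ 2))) (at ?\<xi>)"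
  proof (rule has_derivative_compose[where g = \<alpha> and g' = D])
    show "((\<lambda>\<xi>. fst \<xi> $ 2) has_derivative (\<lambda>d. fst d $ 2)) (at ?\<xi>)"
      by (rule bounded_linear_imp_has_derivative
          bounded_linear_compose[OF bounded_linear_vec_nth bounded_linear_fst])+
    show "(\<alpha> has_derivative D) (at (fst ?\<xi> $ 2))" using D by (simp add: curve_gamma_def)
  qed
  let ?F = "\<lambda>\<xi>::phase. (1/2) * ((snd \<xi>$1)\<^sup>2 +
      (snd \<xi>$2 + (fst \<xi>$1)\<^sup>2 * (fst \<xi>$2)^b * snd \<xi>$3)\<^sup>2
        / (1 - \<alpha> (fst \<xi>$2) * fst \<xi>$1 * (fst \<xi>$2)^a))"
  have "(?F has_derivative
    (\<lambda>(dx, dp). p$1 * dp$1 + p$2 * dp$2 + (1/2) * (p$2)\<^sup>2 * (\<alpha> t * t^a) * dx$1)) (at ?\<xi>)"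
    by (rule derivative_eq_intros \<alpha>_x2 refl
          bounded_linear.has_derivative[OF bounded_linear_vec_nth] | simp add: curve_gamma_def)+
      (auto simp: curve_gamma_def fun_eq_iff algebra_simps power2_eq_square)
  then show ?thesis
  proof (rule has_derivative_transform_within_open)
    show "open (manifold_M \<times> (UNIV :: (real^3) set))"
      by (intro open_Times open_manifold_M open_UNIV)
    show "?\<xi> \<in> manifold_M \<times> UNIV" using curve_gamma_in_manifold_M[OF t] by simp
    show "?F \<xi> = normal_hamiltonian (dist_D b) (metric_g a \<alpha>) \<xi>"
      if "\<xi> \<in> manifold_M \<times> UNIV" for \<xi>
    proof -
      have "fst \<xi> \<in> manifold_M" using that by (simp add: mem_Times_iff)
      from normal_hamiltonian_eq[where \<alpha> = \<alpha>, OF metric_coefficient_pos[OF \<alpha>(2) this], of b a "snd \<xi>"]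
      show ?thesis by simp
    qed
  qed
qed

lemma hamiltonian_vector_field_along_curve_gamma:
  assumes "\<alpha> differentiable (at t)" "\<alpha> ` {-1<..<1} \<subseteq> {0..1}" "t \<in> {-1<..<1}"
  shows "hamiltonian_vector_field (normal_hamiltonian (dist_D b) (metric_g a \<alpha>)) (curve_gamma t, p)
    = (vector [p$1, p$2, 0], vector [- (1/2) * (p$2)\<^sup>2 * (\<alpha> t * t^a), 0, 0])"
  unfolding hamiltonian_vector_field_def
    frechet_derivative_at[OF normal_hamiltonian_has_derivative[OF assms], symmetric]
  by (simp add: vec_eq_iff forall_3 axis_def)

section \<open>The curve is horizontal\<close>

lemma lipschitz_on_imp_absolutely_continuous_curve:
  assumes "C-lipschitz_on I \<eta>"
  shows "absolutely_continuous_curve I \<eta>"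
  unfolding absolutely_continuous_curve_def
proof (intro allI impI)
  fix c d \<epsilon> :: real assume cd: "{c..d} \<subseteq> I" and "\<epsilon> > 0"
  have C: "C \<ge> 0" using assms by (rule lipschitz_on_nonneg)
  show "\<exists>\<delta>>0. \<forall>(n::nat) l u.
      (\<forall>i<n. l i \<le> u i \<and> {l i..u i} \<subseteq> {c..d}) \<and>
      disjoint_family_on (\<lambda>i. {l i<..<u i}) {..<n} \<and> (\<Sum>i<n. u i - l i) < \<delta>
      \<longrightarrow> (\<Sum>i<n. dist (\<eta> (l i)) (\<eta> (u i))) < \<epsilon>"
  proof (intro exI[of _ "\<epsilon> / (C + 1)"] conjI allI impI)
    show "\<epsilon> / (C + 1) > 0" using C \<open>\<epsilon> > 0\<close> by simp
    fix n :: nat and l u :: "nat \<Rightarrow> real"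
    assume H: "(\<forall>i<n. l i \<le> u i \<and> {l i..u i} \<subseteq> {c..d}) \<and>
      disjoint_family_on (\<lambda>i. {l i<..<u i}) {..<n} \<and> (\<Sum>i<n. u i - l i) < \<epsilon> / (C + 1)"
    have "dist (\<eta> (l i)) (\<eta> (u i)) \<le> (C + 1) * (u i - l i)" if "i < n" for i
    proof -
      have lu: "l i \<le> u i" "{l i..u i} \<subseteq> I" using H that cd by blast+
      then have "l i \<in> I" "u i \<in> I" by auto
      then have "dist (\<eta> (l i)) (\<eta> (u i)) \<le> C * dist (l i) (u i)"
        using assms by (intro lipschitz_onD)
      then show ?thesis using lu by (simp add: dist_real_def algebra_simps)
    qed
    then have "(\<Sum>i<n. dist (\<eta> (l i)) (\<eta> (u i))) \<le> (\<Sum>i<n. (C + 1) * (u i - l i))"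
      by (intro sum_mono) auto
    also have "\<dots> = (C + 1) * (\<Sum>i<n. u i - l i)" by (rule sum_distrib_left[symmetric])
    also have "\<dots> < \<epsilon>" using H C by (simp add: field_simps)
    finally show "(\<Sum>i<n. dist (\<eta> (l i)) (\<eta> (u i))) < \<epsilon>" .
  qed
qed

lemma curve_gamma_eq: "curve_gamma t = t *\<^sub>R axis 2 1"
  by (simp add: curve_gamma_def vec_eq_iff forall_3 axis_def)

lemma curve_gamma_has_vector_derivative:
  "(curve_gamma has_vector_derivative vector [0, 1, 0]) (at t within I)"
proof -
  have "vector [0, 1, 0] = (axis 2 1 :: real^3)"
    by (simp add: vec_eq_iff forall_3 axis_def)
  then show ?thesis
    unfolding curve_gamma_eq[abs_def] by (auto intro!: derivative_eq_intros)
qed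

lemma horizontal_curve_gamma:
  assumes "is_interval I" and "I \<subseteq> {-1<..<1}"
  shows "horizontal_curve manifold_M (dist_D b) I curve_gamma"
  unfolding horizontal_curve_def
proof (intro conjI AE_I2 impI)
  show "absolutely_continuous_curve I curve_gamma"
    by (rule lipschitz_on_imp_absolutely_continuous_curve[of 1])
      (auto intro!: lipschitz_onI simp: curve_gamma_eq dist_norm simp flip: scaleR_diff_left)
  fix t
  show "\<exists>v\<in>dist_D b (curve_gamma t). (curve_gamma has_vector_derivative v) (at t within I)"
  proof (rule bexI)
    show "(curve_gamma has_vector_derivative vector [0, 1, 0]) (at t within I)"
      by (rule curve_gamma_has_vector_derivative)
    show "vector [0, 1, 0] \<in> dist_D b (curve_gamma t)"
      by (simp add: in_dist_D_iff curve_gamma_def)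
  qed
qed (use assms curve_gamma_in_manifold_M in auto)

section \<open>The characterisation of normality\<close>

lemma at_within_Icc_nontrivial:
  fixes t1 t2 :: real
  assumes "t1 < t2" "t \<in> {t1..t2}"
  shows "at t within {t1..t2} \<noteq> bot"
  using assms by (simp add: trivial_limit_within islimpt_Icc)

theorem corollary2p5:
  fixes a b :: nat and \<alpha> :: "real \<Rightarrow> real" and t1 t2 :: real
  assumes "a \<ge> 1" and "b \<ge> 1"
    and "smooth_on_open {-1<..<1} \<alpha>" and "\<alpha> ` {-1<..<1} \<subseteq> {0..1}"
    and "t1 \<in> {-1<..<1}" and "t2 \<in> {-1<..<1}" and "t1 < t2"
  shows "normal_curve manifold_M (dist_D b) (metric_g a \<alpha>) {t1..t2} curve_gamma
    \<longleftrightarrow> (\<forall>t\<in>{t1..t2}. \<alpha> t = 0)"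
proof -
  let ?I = "{t1..t2}"
  let ?H = "normal_hamiltonian (dist_D b) (metric_g a \<alpha>)"
  have I: "?I \<subseteq> {-1<..<1}" using assms(5,6) by auto
  have diff: "\<alpha> differentiable (at t)" if "t \<in> ?I" for t
    using assms(3) that I unfolding smooth_on_open_def by (metis funpow_0 subsetD)
  have field: "hamiltonian_vector_field ?H (curve_gamma t, p)
      = (vector [p$1, p$2, 0], vector [- (1/2) * (p$2)\<^sup>2 * (\<alpha> t * t^a), 0, 0])" if "t \<in> ?I" for t p
    using hamiltonian_vector_field_along_curve_gamma[OF diff[OF that] assms(4)] that I by blast
  show ?thesis
  proof
    assume "normal_curve manifold_M (dist_D b) (metric_g a \<alpha>) ?I curve_gamma"
    then obtain \<Lambda> where lift: "\<And>t. t \<in> ?I \<Longrightarrow> fst (\<Lambda> t) = curve_gamma t"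
      and sol: "\<And>t. t \<in> ?I \<Longrightarrow>
        (\<Lambda> has_vector_derivative hamiltonian_vector_field ?H (\<Lambda> t)) (at t within ?I)"
      unfolding normal_curve_def solves_hamilton_equations_def by blast
    define p where "p t = snd (\<Lambda> t)" for t
    have \<Lambda>: "\<Lambda> t = (curve_gamma t, p t)" if "t \<in> ?I" for t
      using lift[OF that] by (simp add: p_def prod_eq_iff)
    have x': "(curve_gamma has_vector_derivative vector [p t$1, p t$2, 0]) (at t within ?I)"
      and p': "(p has_vector_derivative vector [- (1/2) * (p t$2)\<^sup>2 * (\<alpha> t * t^a), 0, 0])
        (at t within ?I)" if t: "t \<in> ?I" for t
    proof -
      note d = sol[OF t, unfolded \<Lambda>[OF t] field[OF t]]
      have "((\<lambda>t. fst (\<Lambda> t)) has_vector_derivative vector [p t$1, p t$2, 0]) (at t within ?I)"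
        using bounded_linear.has_vector_derivative[OF bounded_linear_fst d] by simp
      then show "(curve_gamma has_vector_derivative vector [p t$1, p t$2, 0]) (at t within ?I)"
        by (rule has_vector_derivative_transform[OF t, rotated]) (simp add: lift)
      show "(p has_vector_derivative vector [- (1/2) * (p t$2)\<^sup>2 * (\<alpha> t * t^a), 0, 0])
          (at t within ?I)"
        using bounded_linear.has_vector_derivative[OF bounded_linear_snd d] by (simp add: p_def[abs_def])
    qed
    \<comment> \<open>The Hamilton equations for the position prescribe the velocity \<open>(p\<^sub>1, p\<^sub>2, 0)\<close>, which must be
      that of the curve.\<close>
    have p12: "p t$1 = 0" "p t$2 = 1" if t: "t \<in> ?I" for t
    proof -
      have "(vector [p t$1, p t$2, 0] :: real^3) = vector [0, 1, 0]"
        by (rule vector_derivative_unique_within[OF at_within_Icc_nontrivial[OF assms(7) t]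
              x'[OF t] curve_gamma_has_vector_derivative])
      then show "p t$1 = 0" "p t$2 = 1" by (simp_all add: vec_eq_iff forall_3)
    qed
    have \<alpha>_pow: "\<alpha> t * t^a = 0" if t: "t \<in> ?I" for t
    proof -
      have "((\<lambda>t. p t$1) has_vector_derivative - (1/2) * (\<alpha> t * t^a)) (at t within ?I)"
        using bounded_linear.has_vector_derivative[OF bounded_linear_vec_nth p'[OF t], of 1] p12[OF t]
        by simp
      moreover have "((\<lambda>t. p t$1) has_vector_derivative 0) (at t within ?I)"
        by (rule has_vector_derivative_transform[OF t _ has_vector_derivative_const[of 0]])
          (simp add: p12)
      ultimately have "- (1/2) * (\<alpha> t * t^a) = 0"
        by (rule vector_derivative_unique_within[OF at_within_Icc_nontrivial[OF assms(7) t]])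
      then show ?thesis by simp
    qed
    show "\<forall>t\<in>?I. \<alpha> t = 0"
    proof
      fix t assume t: "t \<in> ?I"
      show "\<alpha> t = 0"
      proof (cases "t = 0")
        case False
        then show ?thesis using \<alpha>_pow[OF t] by simp
      next
        case True
        have "(\<alpha> \<longlongrightarrow> \<alpha> t) (at t within ?I)"
          using differentiable_imp_continuous_within[OF diff[OF t]]
          by (simp add: continuous_at_imp_continuous_at_within flip: continuous_within)
        moreover have "(\<alpha> \<longlongrightarrow> 0) (at t within ?I)"
        proof (rule tendsto_eventually)
          have "\<alpha> s = 0" if "s \<in> ?I" "s \<noteq> t" for s
            using \<alpha>_pow[OF that(1)] that(2) True by simp
          then show "\<forall>\<^sub>F s in at t within ?I. \<alpha> s = 0"
            by (auto simp: eventually_at_filter)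
        qed
        ultimately show ?thesis
          by (rule tendsto_unique[OF at_within_Icc_nontrivial[OF assms(7) t]])
      qed
    qed
  next
    assume \<alpha>0: "\<forall>t\<in>?I. \<alpha> t = 0"
    let ?\<Lambda> = "\<lambda>t. (curve_gamma t, vector [0, 1, 0] :: real^3)"
    have zero: "(vector [0, 0, 0] :: real^3) = 0"
      by (simp add: vec_eq_iff forall_3)
    have "(?\<Lambda> has_vector_derivative hamiltonian_vector_field ?H (?\<Lambda> t)) (at t within ?I)"
      if t: "t \<in> ?I" for t
      using \<alpha>0 t has_vector_derivative_Pair[OF curve_gamma_has_vector_derivative[of t ?I]
          has_vector_derivative_const[of "vector [0, 1, 0] :: real^3"]]
      by (simp add: field[OF t] zero)
    then have "solves_hamilton_equations ?H ?I ?\<Lambda>"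
      by (simp add: solves_hamilton_equations_def)
    moreover have "horizontal_curve manifold_M (dist_D b) ?I curve_gamma"
      using I by (intro horizontal_curve_gamma is_interval_cc)
    ultimately show "normal_curve manifold_M (dist_D b) (metric_g a \<alpha>) ?I curve_gamma"
      unfolding normal_curve_def by (intro conjI exI[of _ ?\<Lambda>]) simp_all
  qed
qed

end
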